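(* Let $f_1,f_2:[a,b]\to\mathbb{R}$ be differentiable on $[a,b]$. Then $f_1'f_2$ is Sequential Henstock integrable on $[a,b]$ if and only if $f_1f_2'$ is Sequential Henstock integrable on $[a,b]$. In that case, $$\int_a^b f_1'f_2=f_1(b)f_2(b)-f_1(a)f_2(a)-\int_a^b f_1f_2'.$$
   Context: Derivatives at the endpoints $a,b$ are one-sided. For $I=[a,b]$: a tagged partition $P=\{([x_{i-1},x_i],t_i)\}_{i=1}^k$ of $I$ consists of points $a=x_0<x_1<\dots<x_k=b$ together with tags $t_i\in[x_{i-1},x_i]$. Its Riemann sum for $f$ is $S(f,P)=\sum_{i=1}^k f(t_i)(x_i-x_{i-1})$. A gauge on $I$ is a function $\delta:I\to\mathbb{R}$ with $\delta(x)>0$ for all $x\in I$. $P$ is $\delta(x)$-fine if $x_i-x_{i-1}<\delta(t_i)$ for every $i$. A function $f:I\to\mathbb{R}$ is Sequential Henstock integrable on $I$ with integral $A=\int_I f=\int_a^b f\in\mathbb{R}$ if there is a sequence of gauges $\{\delta_n\}_{n=1}^\infty$ on $I$ such that, whenever $P_n$ is a $\delta_n(x)$-fine tagged partition of $I$ for each $n$, one has $S(f,P_n)\to A$ as $n\to\infty$. The value of the integral is unique. *)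

theory Defs
  imports "HOL-Analysis.Analysis"
begin

(* (k, x, t) stands for {([x (i-1), x i], t i)} with i = 1, ..., k; only the values
   x 0, ..., x k and t 1, ..., t k matter. *)
type_synonym tagged_part = "nat \<times> (nat \<Rightarrow> real) \<times> (nat \<Rightarrow> real)"

definition tagged_partition :: "real \<Rightarrow> real \<Rightarrow> tagged_part \<Rightarrow> bool" where
  "tagged_partition a b = (\<lambda>(k, x, t).
     x 0 = a \<and> x k = b \<and>
     (\<forall>i\<in>{1..k}. x (i - 1) < x i \<and> t i \<in> {x (i - 1)..x i}))"

definition riemann_sum :: "(real \<Rightarrow> real) \<Rightarrow> tagged_part \<Rightarrow> real" where
  "riemann_sum f = (\<lambda>(k, x, t). \<Sum>i=1..k. f (t i) * (x i - x (i - 1)))"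

(* A real-valued gauge, as opposed to the set-valued constant gauge of HOL-Analysis. *)
definition gauge_on :: "real \<Rightarrow> real \<Rightarrow> (real \<Rightarrow> real) \<Rightarrow> bool" where
  "gauge_on a b \<delta> \<longleftrightarrow> (\<forall>x\<in>{a..b}. \<delta> x > 0)"

definition gauge_fine :: "(real \<Rightarrow> real) \<Rightarrow> tagged_part \<Rightarrow> bool" where
  "gauge_fine \<delta> = (\<lambda>(k, x, t). \<forall>i\<in>{1..k}. x i - x (i - 1) < \<delta> (t i))"

(* Sequences are indexed from 0 instead of 1. *)
definition has_SH_integral :: "(real \<Rightarrow> real) \<Rightarrow> real \<Rightarrow> real \<Rightarrow> real \<Rightarrow> bool" where
  "has_SH_integral f a b A \<longleftrightarrow>
     (\<exists>\<delta> :: nat \<Rightarrow> real \<Rightarrow> real. (\<forall>n. gauge_on a b (\<delta> n)) \<and>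
        (\<forall>P :: nat \<Rightarrow> tagged_part.
           (\<forall>n. tagged_partition a b (P n) \<and> gauge_fine (\<delta> n) (P n)) \<longrightarrow>
           (\<lambda>n. riemann_sum f (P n)) \<longlonglongrightarrow> A))"

definition SH_integrable :: "(real \<Rightarrow> real) \<Rightarrow> real \<Rightarrow> real \<Rightarrow> bool" where
  "SH_integrable f a b \<longleftrightarrow> (\<exists>A. has_SH_integral f a b A)"

definition SH_integral :: "(real \<Rightarrow> real) \<Rightarrow> real \<Rightarrow> real \<Rightarrow> real" where
  "SH_integral f a b = (THE A. has_SH_integral f a b A)"

end

theory Submission
  imports Defs
begin

text \<open>
  The product \<open>f1 * f2\<close> is differentiable, with derivative \<open>f1' * f2 + f1 * f2'\<close>. As with the
  Henstock--Kurzweil integral, \<^emph>\<open>every\<close> derivative on a compact interval is integrable, and its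
  integral is the increment of the primitive (\<open>has_SH_integral_derivative\<close>): a gauge may depend on
  the tag, so it can follow the non-uniform rate at which difference quotients converge. Each
  summand is therefore this integrable sum minus the other summand, and by linearity
  (\<open>has_SH_integral_diff\<close>) one is integrable exactly if the other is. This argument only produces
  numbers to which Riemann sums converge. Passing to the integral as a function of the integrand
  requires that such a number be unique, and so that fine tagged partitions exist
  (\<open>fine_tagged_partition_exists\<close>, Cousin's lemma); otherwise every number would be an integral.
\<close>

lemma tagged_partition_mono:
  assumes "tagged_partition a b (k, x, t)" and "i \<le> j" and "j \<le> k"
  shows "x i \<le> x j"
  using assms(2,3)
proof (induction j rule: dec_induct)
  case (step m)
  have "x m < x (Suc m)"
    using assms(1) step.prems by (auto simp: tagged_partition_def dest: bspec[of _ _ "Suc m"])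
  then show ?case
    using step by simp
qed simp

lemma tagged_partition_point_in_interval:
  assumes "tagged_partition a b (k, x, t)" and "i \<le> k"
  shows "x i \<in> {a..b}"
  using tagged_partition_mono[OF assms(1), of 0 i] tagged_partition_mono[OF assms(1), of i k] assms
  by (auto simp: tagged_partition_def)

lemma tagged_partition_append:
  assumes "tagged_partition a b (k, x, t)" and "gauge_fine \<delta> (k, x, t)"
    and "tagged_partition b c (l, y, s)" and "gauge_fine \<delta> (l, y, s)"
  defines "P \<equiv> (k + l, \<lambda>i. if i \<le> k then x i else y (i - k), \<lambda>i. if i \<le> k then t i else s (i - k))"
  shows "tagged_partition a c P \<and> gauge_fine \<delta> P"
proof -
  let ?x = "\<lambda>i. if i \<le> k then x i else y (i - k)"
  let ?t = "\<lambda>i. if i \<le> k then t i else s (i - k)"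
  have junction: "x k = y 0"
    using assms(1,3) by (simp add: tagged_partition_def)
  have steps: "?x (i - 1) < ?x i \<and> ?t i \<in> {?x (i - 1)..?x i} \<and> ?x i - ?x (i - 1) < \<delta> (?t i)"
    if i: "i \<in> {1..k + l}" for i
  proof (cases "i \<le> k")
    case True
    then show ?thesis
      using assms(1,2) i by (auto simp: tagged_partition_def gauge_fine_def)
  next
    case False
    then have "i - k \<in> {1..l}"
      using i by auto
    then have "y (i - k - 1) < y (i - k) \<and> s (i - k) \<in> {y (i - k - 1)..y (i - k)} \<and>
        y (i - k) - y (i - k - 1) < \<delta> (s (i - k))"
      using assms(3,4) unfolding tagged_partition_def gauge_fine_def prod.case by blast
    \<comment> \<open>For \<open>i = k + 1\<close> the left endpoint is listed as \<open>x k\<close>, not as \<open>y 0\<close>.\<close>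
    moreover have "?x (i - 1) = y (i - k - 1)"
      using False junction by (cases "i = Suc k") auto
    ultimately show ?thesis
      using False by simp
  qed
  have "?x 0 = a" and "?x (k + l) = c"
    using assms(1,3) junction by (cases "l = 0"; auto simp: tagged_partition_def)+
  then show ?thesis
    using steps unfolding P_def tagged_partition_def gauge_fine_def prod.case by blast
qed

text \<open>
  Cousin's lemma, by Bolzano's bisection principle: having a fine tagged partition passes from two
  adjacent intervals to their union, and near each \<open>x\<close> an interval that contains \<open>x\<close> and is
  shorter than \<open>\<delta> x\<close> is, with tag \<open>x\<close>, a fine partition of itself.
\<close>
lemma fine_tagged_partition_exists:
  assumes "a \<le> b" and "gauge_on a b \<delta>"
  shows "\<exists>P. tagged_partition a b P \<and> gauge_fine \<delta> P"
  using assms(1)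
proof (induction rule: Bolzano)
  case (trans a b c)
  then obtain k x t l y s
    where "tagged_partition a b (k, x, t)" "gauge_fine \<delta> (k, x, t)"
      and "tagged_partition b c (l, y, s)" "gauge_fine \<delta> (l, y, s)"
    by (auto simp only: split_paired_Ex)
  from tagged_partition_append[OF this] show ?case ..
next
  case (local x)
  have "\<exists>P. tagged_partition u v P \<and> gauge_fine \<delta> P"
    if uv: "u \<le> x" "x \<le> v" "v - u < \<delta> x" for u v
  proof (cases "u = v")
    case True
    \<comment> \<open>Subintervals are non-degenerate, so a point has only the empty partition.\<close>
    then have "tagged_partition u v (0, \<lambda>_. u, \<lambda>_. u) \<and> gauge_fine \<delta> (0, \<lambda>_. u, \<lambda>_. u)"
      by (simp add: tagged_partition_def gauge_fine_def)
    then show ?thesis ..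
  next
    case False
    then have "tagged_partition u v (1, \<lambda>i. if i = 0 then u else v, \<lambda>_. x) \<and>
        gauge_fine \<delta> (1, \<lambda>i. if i = 0 then u else v, \<lambda>_. x)"
      using uv by (simp add: tagged_partition_def gauge_fine_def)
    then show ?thesis ..
  qed
  moreover have "\<delta> x > 0"
    using assms(2) local by (simp add: gauge_on_def)
  ultimately show ?case
    by blast
qed

lemma gauge_on_min:
  "gauge_on a b (\<lambda>x. min (\<delta> x) (\<epsilon> x)) \<longleftrightarrow> gauge_on a b \<delta> \<and> gauge_on a b \<epsilon>"
  by (auto simp: gauge_on_def)

lemma gauge_fine_min:
  "gauge_fine (\<lambda>x. min (\<delta> x) (\<epsilon> x)) P \<longleftrightarrow> gauge_fine \<delta> P \<and> gauge_fine \<epsilon> P"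
  by (auto simp: gauge_fine_def)

text \<open>
  Two sequences of gauges that witness different integrals have a common refinement, and Cousin's
  lemma supplies partitions fine for it; the same Riemann sums then have both limits.
\<close>
lemma has_SH_integral_unique:
  assumes "a \<le> b" and "has_SH_integral f a b A" and "has_SH_integral f a b B"
  shows "A = B"
proof -
  obtain \<delta> where \<delta>: "\<forall>n. gauge_on a b (\<delta> n)"
    and A: "\<And>P. \<forall>n. tagged_partition a b (P n) \<and> gauge_fine (\<delta> n) (P n) \<Longrightarrow>
      (\<lambda>n. riemann_sum f (P n)) \<longlonglongrightarrow> A"
    using assms(2) unfolding has_SH_integral_def by blast
  obtain \<epsilon> where \<epsilon>: "\<forall>n. gauge_on a b (\<epsilon> n)"
    and B: "\<And>P. \<forall>n. tagged_partition a b (P n) \<and> gauge_fine (\<epsilon> n) (P n) \<Longrightarrow>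
      (\<lambda>n. riemann_sum f (P n)) \<longlonglongrightarrow> B"
    using assms(3) unfolding has_SH_integral_def by blast
  have "\<forall>n. \<exists>P. tagged_partition a b P \<and> gauge_fine (\<lambda>x. min (\<delta> n x) (\<epsilon> n x)) P"
    using assms(1) \<delta> \<epsilon> by (intro allI fine_tagged_partition_exists) (simp_all add: gauge_on_min)
  then obtain P where
    "\<forall>n. tagged_partition a b (P n) \<and> gauge_fine (\<delta> n) (P n) \<and> gauge_fine (\<epsilon> n) (P n)"
    unfolding gauge_fine_min by metis
  then show "A = B"
    using A[of P] B[of P] LIMSEQ_unique by blast
qed

lemma SH_integral_eq:
  assumes "a \<le> b" and "has_SH_integral f a b A"
  shows "SH_integral f a b = A"
  unfolding SH_integral_def using assms has_SH_integral_unique by blast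

lemma riemann_sum_diff:
  "riemann_sum (\<lambda>x. f x - g x) P = riemann_sum f P - riemann_sum g P"
  by (simp add: riemann_sum_def split_beta sum_subtractf left_diff_distrib)

lemma has_SH_integral_diff:
  assumes "has_SH_integral f a b A" and "has_SH_integral g a b B"
  shows "has_SH_integral (\<lambda>x. f x - g x) a b (A - B)"
proof -
  obtain \<delta> where \<delta>: "\<forall>n. gauge_on a b (\<delta> n)"
    and A: "\<And>P. \<forall>n. tagged_partition a b (P n) \<and> gauge_fine (\<delta> n) (P n) \<Longrightarrow>
      (\<lambda>n. riemann_sum f (P n)) \<longlonglongrightarrow> A"
    using assms(1) unfolding has_SH_integral_def by blast
  obtain \<epsilon> where \<epsilon>: "\<forall>n. gauge_on a b (\<epsilon> n)"
    and B: "\<And>P. \<forall>n. tagged_partition a b (P n) \<and> gauge_fine (\<epsilon> n) (P n) \<Longrightarrow>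
      (\<lambda>n. riemann_sum g (P n)) \<longlonglongrightarrow> B"
    using assms(2) unfolding has_SH_integral_def by blast
  have "(\<lambda>n. riemann_sum f (P n) - riemann_sum g (P n)) \<longlonglongrightarrow> A - B"
    if "\<forall>n. tagged_partition a b (P n) \<and> gauge_fine (\<lambda>x. min (\<delta> n x) (\<epsilon> n x)) (P n)" for P
    using that by (intro tendsto_diff A B) (simp_all add: gauge_fine_min)
  moreover have "\<forall>n. gauge_on a b (\<lambda>x. min (\<delta> n x) (\<epsilon> n x))"
    using \<delta> \<epsilon> by (simp add: gauge_on_min)
  ultimately show ?thesis
    unfolding has_SH_integral_def riemann_sum_diff
    by (intro exI[of _ "\<lambda>n x. min (\<delta> n x) (\<epsilon> n x)"]) simp
qed

text \<open>
  The straddle lemma: the increment of \<open>F\<close> over an interval that contains the tag is the difference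
  of its increments from the tag to the two endpoints. Both endpoints are within \<open>\<delta>\<close> of the tag, and
  their distances to the tag add up to the length, so the two errors of linearization add up to at
  most \<open>e\<close> times the length. Along the partition, the increments and the lengths telescope.
\<close>
lemma riemann_sum_derivative_error:
  assumes P: "tagged_partition a b P" and fine: "gauge_fine \<delta> P"
    and linear: "\<And>t y. t \<in> {a..b} \<Longrightarrow> y \<in> {a..b} \<Longrightarrow> \<bar>y - t\<bar> < \<delta> t \<Longrightarrow>
      \<bar>F y - F t - F' t * (y - t)\<bar> \<le> e * \<bar>y - t\<bar>"
  shows "\<bar>riemann_sum F' P - (F b - F a)\<bar> \<le> e * (b - a)"
proof -
  obtain k x t where P_eq: "P = (k, x, t)"
    by (cases P)
  have ends: "x 0 = a" "x k = b"
    using P by (auto simp: P_eq tagged_partition_def)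
  have telescope: "(\<Sum>i=1..k. G (x i) - G (x (i - 1))) = G b - G a" for G :: "real \<Rightarrow> real"
    using sum_telescope''[of 0 k "\<lambda>i. G (x i)"] by (simp add: ends)
  have straddle: "\<bar>F' (t i) * (x i - x (i - 1)) - (F (x i) - F (x (i - 1)))\<bar> \<le> e * (x i - x (i - 1))"
    if i: "i \<in> {1..k}" for i
  proof -
    have t: "x (i - 1) \<le> t i" "t i \<le> x i" and short: "x i - x (i - 1) < \<delta> (t i)"
      using P fine i by (auto simp: P_eq tagged_partition_def gauge_fine_def)
    have x: "x (i - 1) \<in> {a..b}" "x i \<in> {a..b}"
      using P i tagged_partition_point_in_interval[of a b k x t "i - 1"]
        tagged_partition_point_in_interval[of a b k x t i] by (auto simp: P_eq)
    then have "t i \<in> {a..b}"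
      using t by auto
    then have left: "\<bar>F (x (i - 1)) - F (t i) - F' (t i) * (x (i - 1) - t i)\<bar> \<le> e * (t i - x (i - 1))"
      and right: "\<bar>F (x i) - F (t i) - F' (t i) * (x i - t i)\<bar> \<le> e * (x i - t i)"
      using linear[of "t i" "x (i - 1)"] linear[of "t i" "x i"] t short x by auto
    have "\<bar>F' (t i) * (x i - x (i - 1)) - (F (x i) - F (x (i - 1)))\<bar> =
        \<bar>(F (x (i - 1)) - F (t i) - F' (t i) * (x (i - 1) - t i)) -
         (F (x i) - F (t i) - F' (t i) * (x i - t i))\<bar>"
      by (rule arg_cong[where f = abs]) (simp add: algebra_simps)
    also have "\<dots> \<le> e * (t i - x (i - 1)) + e * (x i - t i)"
      by (rule order_trans[OF abs_triangle_ineq4 add_mono[OF left right]])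
    also have "\<dots> = e * (x i - x (i - 1))"
      by (simp add: right_diff_distrib)
    finally show ?thesis .
  qed
  have "riemann_sum F' P - (F b - F a) =
      (\<Sum>i=1..k. F' (t i) * (x i - x (i - 1)) - (F (x i) - F (x (i - 1))))"
    using telescope[of F] by (simp only: P_eq riemann_sum_def prod.case sum_subtractf)
  then have "\<bar>riemann_sum F' P - (F b - F a)\<bar> =
      \<bar>\<Sum>i=1..k. F' (t i) * (x i - x (i - 1)) - (F (x i) - F (x (i - 1)))\<bar>"
    by (rule arg_cong)
  also have "\<dots> \<le> (\<Sum>i=1..k. e * (x i - x (i - 1)))"
    by (rule order_trans[OF sum_abs sum_mono[OF straddle]])
  also have "\<dots> = e * (b - a)"
    by (simp only: sum_distrib_left[symmetric] telescope[of "\<lambda>y. y"])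
  finally show ?thesis .
qed

text \<open>
  The \<open>n\<close>-th gauge is chosen, tag by tag, so that linearization of \<open>F\<close> has relative error at most
  \<open>1 / (n + 1)\<close>; the Riemann sums of fine partitions then err by at most \<open>(b - a) / (n + 1)\<close>.
\<close>
lemma has_SH_integral_derivative:
  assumes deriv: "\<And>x. x \<in> {a..b} \<Longrightarrow> (F has_real_derivative F' x) (at x within {a..b})"
  shows "has_SH_integral F' a b (F b - F a)"
proof -
  define e where "e n = inverse (real (Suc n))" for n
  define good where "good n t d \<longleftrightarrow> d > 0 \<and> (t \<in> {a..b} \<longrightarrow>
      (\<forall>y\<in>{a..b}. \<bar>y - t\<bar> < d \<longrightarrow> \<bar>F y - F t - F' t * (y - t)\<bar> \<le> e n * \<bar>y - t\<bar>))" for n t d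
  have "\<exists>d. good n t d" for n t
  proof (cases "t \<in> {a..b}")
    case True
    have "e n > 0"
      by (simp add: e_def)
    then show ?thesis
      using deriv[OF True]
      unfolding good_def has_field_derivative_def has_derivative_within_alt real_norm_def by blast
  qed (auto simp: good_def intro: exI[of _ 1])
  then obtain \<delta> where good: "\<And>n t. good n t (\<delta> n t)"
    by metis
  then have \<delta>: "\<And>n t. \<delta> n t > 0"
    and linear: "\<And>n t y. t \<in> {a..b} \<Longrightarrow> y \<in> {a..b} \<Longrightarrow> \<bar>y - t\<bar> < \<delta> n t \<Longrightarrow>
      \<bar>F y - F t - F' t * (y - t)\<bar> \<le> e n * \<bar>y - t\<bar>"
    unfolding good_def by blast+
  have "(\<lambda>n. riemann_sum F' (P n)) \<longlonglongrightarrow> F b - F a"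
    if P: "\<forall>n. tagged_partition a b (P n) \<and> gauge_fine (\<delta> n) (P n)" for P
  proof -
    have "\<bar>riemann_sum F' (P n) - (F b - F a)\<bar> \<le> e n * (b - a)" for n
      using P linear by (intro riemann_sum_derivative_error[where \<delta> = "\<delta> n"]) auto
    then have "\<forall>\<^sub>F n in sequentially.
        norm (riemann_sum F' (P n) - (F b - F a)) \<le> e n * (b - a)"
      by simp
    moreover have "(\<lambda>n. e n * (b - a)) \<longlonglongrightarrow> 0"
      unfolding e_def by (intro tendsto_mult_left_zero LIMSEQ_inverse_real_of_nat)
    ultimately have "(\<lambda>n. riemann_sum F' (P n) - (F b - F a)) \<longlonglongrightarrow> 0"
      by (rule Lim_null_comparison)
    then show ?thesis
      by (rule LIM_zero_cancel)
  qed
  then show ?thesis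
    using \<delta> unfolding has_SH_integral_def gauge_on_def by blast
qed

theorem theorem11:
  fixes f1 f2 f1' f2' :: "real \<Rightarrow> real" and a b :: real
  assumes "a < b"
    and "\<And>x. x \<in> {a..b} \<Longrightarrow> (f1 has_real_derivative f1' x) (at x within {a..b})"
    and "\<And>x. x \<in> {a..b} \<Longrightarrow> (f2 has_real_derivative f2' x) (at x within {a..b})"
  shows "(SH_integrable (\<lambda>x. f1' x * f2 x) a b \<longleftrightarrow> SH_integrable (\<lambda>x. f1 x * f2' x) a b) \<and>
    (SH_integrable (\<lambda>x. f1' x * f2 x) a b \<longrightarrow>
       SH_integral (\<lambda>x. f1' x * f2 x) a b =
         f1 b * f2 b - f1 a * f2 a - SH_integral (\<lambda>x. f1 x * f2' x) a b)"
proof -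
  let ?C = "f1 b * f2 b - f1 a * f2 a"
  have product: "has_SH_integral (\<lambda>x. f1' x * f2 x + f1 x * f2' x) a b ?C"
    by (rule has_SH_integral_derivative[where F = "\<lambda>x. f1 x * f2 x"])
       (use DERIV_mult[OF assms(2,3)] in \<open>simp add: algebra_simps\<close>)
  have to_right: "has_SH_integral (\<lambda>x. f1 x * f2' x) a b (?C - A)"
    if "has_SH_integral (\<lambda>x. f1' x * f2 x) a b A" for A
    using has_SH_integral_diff[OF product that] by simp
  have to_left: "has_SH_integral (\<lambda>x. f1' x * f2 x) a b (?C - A)"
    if "has_SH_integral (\<lambda>x. f1 x * f2' x) a b A" for A
    using has_SH_integral_diff[OF product that] by simp
  have "SH_integral (\<lambda>x. f1' x * f2 x) a b = ?C - SH_integral (\<lambda>x. f1 x * f2' x) a b"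
    if "has_SH_integral (\<lambda>x. f1' x * f2 x) a b A" for A
    using SH_integral_eq[OF _ that] SH_integral_eq[OF _ to_right[OF that]] assms(1) by simp
  then show ?thesis
    using to_left to_right unfolding SH_integrable_def by blast
qed

end
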